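(* Let $\mathscr A$ be a prime $C^*$-algebra with unit $I$, and let $\phi:\mathscr A\to\mathscr A$ be a surjective map (linearity not assumed) such that \[ |\phi(A)\phi(B)^*|=|AB^*|\qquad(A,B\in\mathscr A). \] Then there exist a unitary element $U\in\mathscr A$ and a phase-function $\varphi:\mathscr A\to\mathbb C$ such that $\phi(A)=\varphi(A)\,AU$ for all $A\in\mathscr A$.
   Context: A ring $\mathcal R$ is prime if for $a,b\in\mathcal R$, $a\mathcal R b=\{0\}$ implies $a=0$ or $b=0$. For $x$ in a $C^*$-algebra, $|x|=(x^*x)^{1/2}$. A phase-function is a function $\varphi:\mathscr A\to\mathbb C$ with $|\varphi(A)|=1$ for all $A$. *)

theory Defs
  imports Complex_Main
begin

class cstar_algebra = real_normed_algebra_1 + banach +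
  fixes cscale :: "complex \<Rightarrow> 'a \<Rightarrow> 'a"
    and cstar :: "'a \<Rightarrow> 'a"
  assumes cscale_add_left: "cscale (a + b) x = cscale a x + cscale b x"
    and cscale_add_right: "cscale a (x + y) = cscale a x + cscale a y"
    and cscale_mult: "cscale (a * b) x = cscale a (cscale b x)"
    and cscale_one: "cscale 1 x = x"
    and cscale_of_real: "cscale (complex_of_real r) x = scaleR r x"
    and norm_cscale: "norm (cscale a x) = cmod a * norm x"
    and cscale_mult_left: "cscale a (x * y) = cscale a x * y"
    and cscale_mult_right: "cscale a (x * y) = x * cscale a y"
    and cstar_cstar: "cstar (cstar x) = x"
    and cstar_add: "cstar (x + y) = cstar x + cstar y"
    and cstar_cscale: "cstar (cscale a x) = cscale (cnj a) (cstar x)"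
    and cstar_mult: "cstar (x * y) = cstar y * cstar x"
    and cstar_identity: "norm (cstar x * x) = norm x ^ 2"

definition prime_ring :: "'a::ring itself \<Rightarrow> bool" where
  "prime_ring (_::'a itself) \<longleftrightarrow>
     (\<forall>a b :: 'a. (\<forall>x. a * x * b = 0) \<longrightarrow> a = 0 \<or> b = 0)"

definition cspectrum :: "'a::cstar_algebra \<Rightarrow> complex set" where
  "cspectrum x = {c. \<not> (\<exists>y. (x - cscale c 1) * y = 1 \<and> y * (x - cscale c 1) = 1)}"

definition cpositive :: "'a::cstar_algebra \<Rightarrow> bool" where
  "cpositive x \<longleftrightarrow> cstar x = x \<and> cspectrum x \<subseteq> complex_of_real ` {0..}"

definition cabs :: "'a::cstar_algebra \<Rightarrow> 'a" where
  "cabs x = (THE r. cpositive r \<and> r * r = cstar x * x)"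

definition unitary :: "'a::cstar_algebra \<Rightarrow> bool" where
  "unitary u \<longleftrightarrow> cstar u * u = 1 \<and> u * cstar u = 1"

end

theory Submission
  imports Defs "HOL-Analysis.Analysis"
begin

text \<open>As \<open>|x|\<^sup>2 = x\<^sup>* x\<close>, the hypothesis says \<open>\<phi> B (\<phi> A)\<^sup>* (\<phi> A) (\<phi> B)\<^sup>* = B A\<^sup>* A B\<^sup>*\<close>. Hence
  \<open>W = \<phi> 1\<close> is unitary, and \<open>C = \<phi> B W\<^sup>*\<close> satisfies \<open>C X C\<^sup>* = B X B\<^sup>*\<close> first for \<open>X = A\<^sup>* A\<close> and then
  for all \<open>X\<close>. With \<open>P = B B\<^sup>*\<close> and \<open>Q = B C\<^sup>*\<close> this gives \<open>Q Y P = P Y Q\<close> for all \<open>Y\<close>. For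
  selfadjoint \<open>h\<close>, the relation \<open>h Y P = P Y h\<close> and primeness force \<open>h \<ge> 0\<close> or \<open>h \<le> 0\<close>; applied to
  \<open>h - t P\<close> for all real \<open>t\<close>, this makes \<open>h\<close> a real multiple of \<open>P\<close>. So \<open>Q\<close> is a scalar multiple
  \<open>l P\<close>, with \<open>|l| = 1\<close>, and \<open>(B - l C) (B - l C)\<^sup>* = 0\<close>.\<close>

section \<open>Scalars and the involution\<close>

lemma cscale_zero_left [simp]: "cscale 0 (x::'a::cstar_algebra) = 0"
  using cscale_add_left[of 0 0 x] by simp

lemma cscale_zero_right [simp]: "cscale c (0::'a::cstar_algebra) = 0"
  using cscale_add_right[of c 0 0] by simp

lemma cscale_minus_left: "cscale (- c) (x::'a::cstar_algebra) = - cscale c x"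
  using cscale_add_left[of "- c" c x] by (simp add: eq_neg_iff_add_eq_0)

lemma cscale_minus_right: "cscale c (- (x::'a::cstar_algebra)) = - cscale c x"
  using cscale_add_right[of c "- x" x] by (simp add: eq_neg_iff_add_eq_0)

lemma cscale_diff_left: "cscale (a - b) (x::'a::cstar_algebra) = cscale a x - cscale b x"
  using cscale_add_left[of a "- b" x] by (simp add: cscale_minus_left)

lemma cscale_diff_right: "cscale c ((x::'a::cstar_algebra) - y) = cscale c x - cscale c y"
  using cscale_add_right[of c x "- y"] by (simp add: cscale_minus_right)

lemma mult_cscale_left [simp]: "cscale c (x::'a::cstar_algebra) * y = cscale c (x * y)"
  by (simp add: cscale_mult_left)

lemma mult_cscale_right [simp]: "(x::'a::cstar_algebra) * cscale c y = cscale c (x * y)"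
  by (simp add: cscale_mult_right)

lemma cscale_cscale [simp]: "cscale a (cscale b (x::'a::cstar_algebra)) = cscale (a * b) x"
  by (simp add: cscale_mult)

lemma cscale_1 [simp]: "cscale 1 (x::'a::cstar_algebra) = x"
  by (rule cscale_one)

lemma cstar_zero [simp]: "cstar (0::'a::cstar_algebra) = 0"
  using cstar_add[of "0::'a" 0] by simp

lemma cstar_minus: "cstar (- (x::'a::cstar_algebra)) = - cstar x"
  using cstar_add[of "- x" x] by (simp add: eq_neg_iff_add_eq_0)

lemma cstar_diff: "cstar ((x::'a::cstar_algebra) - y) = cstar x - cstar y"
  using cstar_add[of x "- y"] by (simp add: cstar_minus)

lemma cstar_one [simp]: "cstar (1::'a::cstar_algebra) = 1"
  using cstar_mult[of "cstar 1" "1::'a"] by (simp add: cstar_cstar)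

lemma cstar_scaleR: "cstar (r *\<^sub>R (x::'a::cstar_algebra)) = r *\<^sub>R cstar x"
  using cstar_cscale[of "complex_of_real r" x] by (simp add: cscale_of_real)

text \<open>The C*-identity and submultiplicativity bound \<open>norm y\<close> by
  \<open>norm (cstar y)\<close>; this is applied to \<open>x\<close> and to
  \<open>cstar x\<close>.\<close>

lemma norm_cstar [simp]: "norm (cstar (x::'a::cstar_algebra)) = norm x"
proof -
  have le: "norm y \<le> norm (cstar y)" for y :: 'a
  proof (cases "y = 0")
    case False
    have "norm y * norm y \<le> norm (cstar y) * norm y"
      using norm_mult_ineq[of "cstar y" y] by (simp add: cstar_identity power2_eq_square)
    then show ?thesis using False by simp
  qed simp
  show ?thesis using le[of x] le[of "cstar x"] by (simp add: cstar_cstar)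
qed

lemma tendsto_cstar:
  assumes "(f \<longlongrightarrow> (l::'a::cstar_algebra)) F"
  shows "((\<lambda>x. cstar (f x)) \<longlongrightarrow> cstar l) F"
  using assms unfolding tendsto_iff dist_norm
  by (simp flip: cstar_diff)

lemma norm_selfadjoint_square:
  "cstar x = x \<Longrightarrow> norm (x * x) = norm (x::'a::cstar_algebra) ^ 2"
  using cstar_identity[of x] by simp

lemma selfadjoint_square_eq_0:
  assumes "cstar x = x" "x * x = (0::'a::cstar_algebra)"
  shows "x = 0"
  using norm_selfadjoint_square[OF assms(1)] assms(2) by simp

lemma cstar_mult_self_eq_0:
  assumes "cstar x * x = (0::'a::cstar_algebra)"
  shows "x = 0"
  using cstar_identity[of x] assms by simp

lemma mult_cstar_self_eq_0:
  assumes "x * cstar x = (0::'a::cstar_algebra)"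
  shows "x = 0"
  using cstar_mult_self_eq_0[of "cstar x"] norm_cstar[of x] assms by (simp add: cstar_cstar)

text \<open>The fourth power vanishes as well, so the statement about squares can be applied
  twice.\<close>

lemma selfadjoint_cube_eq_0:
  assumes "cstar x = x" "x * x * x = (0::'a::cstar_algebra)"
  shows "x = 0"
proof -
  have "(x * x) * (x * x) = 0"
    using assms(2) by (simp flip: mult.assoc)
  then have "x * x = 0"
    by (rule selfadjoint_square_eq_0[rotated]) (simp add: cstar_mult assms(1))
  then show ?thesis by (rule selfadjoint_square_eq_0[OF assms(1)])
qed

section \<open>Spectra\<close>

definition inverse_pair :: "'a::ring_1 \<Rightarrow> 'a \<Rightarrow> bool" where
  "inverse_pair x y \<longleftrightarrow> x * y = 1 \<and> y * x = 1"

lemma mem_cspectrum_iff: "c \<in> cspectrum x \<longleftrightarrow> \<not> (\<exists>y. inverse_pair (x - cscale c 1) y)"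
  by (simp add: cspectrum_def inverse_pair_def)

lemma inverse_pair_cscale:
  assumes "inverse_pair (x::'a::cstar_algebra) y" "c \<noteq> 0"
  shows "inverse_pair (cscale c x) (cscale (1/c) y)"
  using assms by (simp add: inverse_pair_def)

lemma ex_inverse_cscale_iff:
  assumes "c \<noteq> 0"
  shows "(\<exists>y. inverse_pair (cscale c x) y) \<longleftrightarrow> (\<exists>y. inverse_pair (x::'a::cstar_algebra) y)"
proof
  assume "\<exists>y. inverse_pair (cscale c x) y"
  then obtain y where "inverse_pair (cscale c x) y" ..
  from inverse_pair_cscale[OF this, of "1/c"] assms show "\<exists>y. inverse_pair x y" by auto
qed (use inverse_pair_cscale assms in blast)

lemma ex_inverse_minus_iff:
  "(\<exists>y. inverse_pair (- x) y) \<longleftrightarrow> (\<exists>y. inverse_pair (x::'a::cstar_algebra) y)"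
  using ex_inverse_cscale_iff[of "-1" x] by (simp add: cscale_minus_left)

text \<open>Away from 0 the spectrum is governed by \<open>1 - cscale (1/c) x\<close>, the shape
  needed for the Neumann series and for exchanging \<open>a * b\<close> with
  \<open>b * a\<close>.\<close>

lemma mem_cspectrum_iff':
  assumes "c \<noteq> 0"
  shows "c \<in> cspectrum x \<longleftrightarrow> \<not> (\<exists>y. inverse_pair (1 - cscale (1/c) x) y)"
proof -
  have "x - cscale c 1 = cscale (- c) (1 - cscale (1/c) x)"
    using assms by (simp add: cscale_diff_right cscale_minus_left)
  then show ?thesis
    using ex_inverse_cscale_iff[of "- c" "1 - cscale (1/c) x"] assms
    by (simp only: mem_cspectrum_iff) simp
qed

text \<open>Neumann series: the geometric series in \<open>x\<close> converges to the
  inverse.\<close>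

lemma ex_inverse_one_minus:
  fixes x :: "'a::{real_normed_algebra_1,banach}"
  assumes "norm x < 1"
  shows "\<exists>y. inverse_pair (1 - x) y"
proof -
  have S: "summable (\<lambda>n. x ^ n)"
    using complete_algebra_summable_geometric[OF assms] .
  let ?y = "\<Sum>n. x ^ n"
  have "?y = 1 + (\<Sum>n. x ^ Suc n)"
    using suminf_split_head[OF S] by simp
  moreover have "(\<Sum>n. x ^ Suc n) = x * ?y"
    using suminf_mult[OF S, of x] by simp
  moreover have "(\<Sum>n. x ^ Suc n) = ?y * x"
    using suminf_mult2[OF S, of x] by (simp add: power_commutes)
  ultimately have "(1 - x) * ?y = 1" "?y * (1 - x) = 1"
    by (simp_all add: left_diff_distrib right_diff_distrib)
  then show ?thesis unfolding inverse_pair_def by blast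
qed

lemma cspectrum_norm_le:
  assumes "c \<in> cspectrum (x::'a::cstar_algebra)"
  shows "cmod c \<le> norm x"
proof (rule ccontr)
  assume a: "\<not> cmod c \<le> norm x"
  then have "c \<noteq> 0" using norm_ge_zero[of x] by auto
  have "norm (cscale (1/c) x) < 1"
    using a \<open>c \<noteq> 0\<close> by (simp add: norm_cscale norm_divide)
  from ex_inverse_one_minus[OF this] assms \<open>c \<noteq> 0\<close> show False
    by (simp add: mem_cspectrum_iff')
qed

lemma cspectrum_shift:
  "c \<in> cspectrum (x + cscale d 1) \<longleftrightarrow> c - d \<in> cspectrum (x::'a::cstar_algebra)"
proof -
  have "x + cscale d 1 - cscale c 1 = x - cscale (c - d) 1"
    by (simp add: cscale_diff_left)
  then show ?thesis by (simp only: mem_cspectrum_iff)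
qed

lemma cspectrum_minus:
  "c \<in> cspectrum (- x) \<longleftrightarrow> - c \<in> cspectrum (x::'a::cstar_algebra)"
proof -
  have "- x - cscale c 1 = - (x - cscale (- c) 1)"
    by (simp add: cscale_minus_left)
  then show ?thesis by (simp only: mem_cspectrum_iff ex_inverse_minus_iff)
qed

text \<open>Formally, the geometric series in \<open>b * a\<close> is 1 plus \<open>b\<close> times
  the series in \<open>a * b\<close> times \<open>a\<close>; this suggests the inverse
  \<open>1 + b * y * a\<close>.\<close>

lemma ex_inverse_one_minus_mult_commute:
  assumes "\<exists>y. inverse_pair (1 - a * b) (y::'a::ring_1)"
  shows "\<exists>y. inverse_pair (1 - b * a) y"
proof -
  obtain y where y: "(1 - a * b) * y = 1" "y * (1 - a * b) = 1"
    using assms inverse_pair_def by blast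
  have "(1 - b * a) * (1 + b * y * a) = 1 - b * a + b * ((1 - a * b) * y) * a"
    by (simp add: algebra_simps)
  moreover have "(1 + b * y * a) * (1 - b * a) = 1 - b * a + b * (y * (1 - a * b)) * a"
    by (simp add: algebra_simps)
  ultimately have "inverse_pair (1 - b * a) (1 + b * y * a)"
    by (simp add: inverse_pair_def y)
  then show ?thesis ..
qed

lemma cspectrum_mult_commute:
  assumes "c \<in> cspectrum ((a::'a::cstar_algebra) * b)" "c \<noteq> 0"
  shows "c \<in> cspectrum (b * a)"
  using assms ex_inverse_one_minus_mult_commute[of "cscale (1/c) b" a]
  by (auto simp: mem_cspectrum_iff')

text \<open>Arens' trick: translating by a large multiple of \<open>\<i>\<close> moves a non-real point of the
  spectrum outside the disc that the norm allows.\<close>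
lemma cspectrum_selfadjoint_real:
  assumes sa: "cstar x = (x::'a::cstar_algebra)" and c: "c \<in> cspectrum x"
  shows "c = complex_of_real (Re c)"
proof (rule ccontr)
  assume "c \<noteq> complex_of_real (Re c)"
  then have im: "Im c \<noteq> 0" by (auto simp: complex_eq_iff)
  \<comment> \<open>Chosen so that \<open>2 * Im c * g\<close> exceeds \<open>norm x ^ 2\<close> by
    1, whatever the sign of \<open>Im c\<close>.\<close>
  define g where "g = (norm x ^ 2 + 1) / (2 * Im c)"
  define y where "y = x + cscale (\<i> * g) 1"
  have "c + \<i> * g \<in> cspectrum y"
    unfolding y_def using c by (subst cspectrum_shift) simp
  then have "cmod (c + \<i> * g) ^ 2 \<le> norm y ^ 2"
    using cspectrum_norm_le by (simp add: power_mono)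
  also have "norm y ^ 2 = norm (cstar y * y)" by (simp add: cstar_identity)
  \<comment> \<open>The cross terms cancel, as \<open>x\<close> is selfadjoint and the shift is
    imaginary.\<close>
  also have "cstar y * y = x * x + (g * g) *\<^sub>R 1"
    unfolding y_def
    by (simp add: cstar_add cstar_cscale sa algebra_simps cscale_add_right
        cscale_minus_left cscale_diff_right flip: cscale_of_real)
  also have "norm \<dots> \<le> norm x ^ 2 + g ^ 2"
  proof -
    have "norm (x * x + (g * g) *\<^sub>R 1) \<le> norm (x * x) + norm ((g * g) *\<^sub>R (1::'a))"
      by (rule norm_triangle_ineq)
    also have "\<dots> = norm x ^ 2 + g ^ 2"
      using sa by (simp add: norm_selfadjoint_square power2_eq_square)
    finally show ?thesis .
  qed
  finally have "Re c ^ 2 + (Im c + g) ^ 2 \<le> norm x ^ 2 + g ^ 2"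
    by (simp add: cmod_power2)
  then have "Re c ^ 2 + Im c ^ 2 + 2 * Im c * g \<le> norm x ^ 2"
    by (simp add: power2_sum)
  moreover have "2 * Im c * g = norm x ^ 2 + 1" using im by (simp add: g_def)
  ultimately show False using sum_power2_ge_zero[of "Re c" "Im c"] by simp
qed

section \<open>Spectral radius of selfadjoint elements\<close>

text \<open>Partial fractions: \<open>2 / (1 - a * a)\<close> is the sum of
  \<open>1 / (1 - a)\<close> and \<open>1 / (1 + a)\<close>.\<close>

lemma inverse_pair_difference_of_squares:
  fixes a :: "'a::real_algebra_1"
  assumes "inverse_pair (1 - a) y" "inverse_pair (1 + a) z"
  shows "inverse_pair (1 - a * a) ((1/2) *\<^sub>R (y + z))"
proof -
  have e: "1 - a * a = (1 + a) * (1 - a)" "1 - a * a = (1 - a) * (1 + a)"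
    by (simp_all add: algebra_simps)
  have y: "(1 - a) * y = 1" "y * (1 - a) = 1" and z: "(1 + a) * z = 1" "z * (1 + a) = 1"
    using assms by (simp_all add: inverse_pair_def)
  have "(1 - a * a) * y = 1 + a"
    unfolding e(1) by (simp add: mult.assoc y)
  moreover have "y * (1 - a * a) = 1 + a"
    unfolding e(2) by (simp add: y flip: mult.assoc)
  moreover have "(1 - a * a) * z = 1 - a"
    unfolding e(2) by (simp add: mult.assoc z)
  moreover have "z * (1 - a * a) = 1 - a"
    unfolding e(1) by (simp add: z flip: mult.assoc)
  ultimately have "(1 - a * a) * (y + z) = 2" "(y + z) * (1 - a * a) = 2"
    by (simp_all only: distrib_left distrib_right) simp_all
  moreover have "(1/2) *\<^sub>R (1 + 1::'a) = 1"
    by (simp only: scaleR_add_right flip: scaleR_add_left) simp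
  ultimately show ?thesis by (simp add: inverse_pair_def)
qed

text \<open>Rickart's elementary route to the spectral radius formula. If \<open>1 - z h\<close> were invertible
  for all \<open>z\<close> in the closed disc, its inverse \<open>E z\<close> would be uniformly continuous there. Averaging
  over \<open>\<plusminus>w\<close> carries the modulus of continuity from \<open>h\<close> to \<open>h\<^sup>2\<close>, \<open>h\<^sup>4\<close>, \<open>\<dots>\<close>, while the
  inner radius \<open>r ^ (2 ^ m)\<close> tends to \<open>0\<close>; this forces \<open>h ^ (2 ^ m)\<close> to become small.\<close>
lemma ex_not_invertible_on_circle:
  fixes h :: "'a::cstar_algebra"
  assumes h: "\<And>m. norm (h ^ (2 ^ m)) = 1"
  shows "\<exists>z. cmod z = 1 \<and> \<not> (\<exists>y. inverse_pair (1 - cscale z h) y)"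
proof (rule ccontr)
  assume neg: "\<not> ?thesis"
  have nh: "norm h = 1" using h[of 0] by simp
  have "\<exists>y. inverse_pair (1 - cscale z h) y" if "z \<in> cball 0 1" for z
  proof (cases "cmod z = 1")
    case False
    with that nh have "norm (cscale z h) < 1" by (simp add: norm_cscale)
    then show ?thesis by (rule ex_inverse_one_minus)
  qed (use neg in blast)
  then obtain E where E: "inverse_pair (1 - cscale z h) (E z)" if "z \<in> cball 0 1" for z
    by metis
  \<comment> \<open>Resolvent identity.\<close>
  have diff: "norm (E z - E w) \<le> norm (E z) * norm (E w) * dist z w"
    if z: "z \<in> cball 0 1" and w: "w \<in> cball 0 1" for z w
  proof -
    have ez: "E z * (1 - cscale z h) = 1" and ew: "(1 - cscale w h) * E w = 1"
      using E[OF z] E[OF w] by (simp_all add: inverse_pair_def)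
    have "E z * ((1 - cscale w h) - (1 - cscale z h)) * E w
        = E z * ((1 - cscale w h) * E w) - (E z * (1 - cscale z h)) * E w"
      by (simp only: left_diff_distrib right_diff_distrib mult.assoc)
    also have "\<dots> = E z - E w" by (simp only: ez ew) simp
    also have "(1 - cscale w h) - (1 - cscale z h) = cscale (z - w) h"
      by (simp add: cscale_diff_left)
    finally have "E z - E w = E z * cscale (z - w) h * E w" by simp
    also have "norm \<dots> \<le> norm (E z) * norm (cscale (z - w) h) * norm (E w)"
      by (meson mult_right_mono norm_ge_zero norm_mult_ineq order_trans)
    finally show ?thesis by (simp add: norm_cscale nh dist_norm mult_ac)
  qed
  have pos: "norm (E z) > 0" if "z \<in> cball 0 1" for z
    using E[OF that] by (auto simp: inverse_pair_def)
  \<comment> \<open>By \<open>diff\<close> the reciprocal of \<open>norm (E z)\<close> is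
    1-Lipschitz before any bound on \<open>E\<close> is known; compactness of the disc then yields
    the bound \<open>M\<close>.\<close>
  have "continuous_on (cball 0 1) (\<lambda>z. 1 / norm (E z))"
  proof (rule lipschitz_on_continuous_on[where L = 1], rule lipschitz_onI)
    fix z w :: complex assume z: "z \<in> cball 0 1" and w: "w \<in> cball 0 1"
    have "dist (1 / norm (E z)) (1 / norm (E w))
        = \<bar>norm (E z) - norm (E w)\<bar> / (norm (E z) * norm (E w))"
      using pos[OF z] pos[OF w]
      by (simp add: dist_real_def divide_simps abs_mult abs_minus_commute)
    also have "\<dots> \<le> norm (E z - E w) / (norm (E z) * norm (E w))"
      by (intro divide_right_mono norm_triangle_ineq3) auto
    also have "\<dots> \<le> dist z w"
      using diff[OF z w] pos[OF z] pos[OF w] by (simp add: divide_le_eq mult_ac)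
    finally show "dist (1 / norm (E z)) (1 / norm (E w)) \<le> 1 * dist z w" by simp
  qed simp
  from continuous_attains_inf[OF compact_cball _ this] obtain z0 where z0: "z0 \<in> cball 0 1"
    and inf: "\<And>z. z \<in> cball 0 1 \<Longrightarrow> 1 / norm (E z0) \<le> 1 / norm (E z)"
    by fastforce
  define M where "M = norm (E z0)"
  have M0: "M > 0" using pos[OF z0] by (simp add: M_def)
  have M: "norm (E z) \<le> M" if "z \<in> cball 0 1" for z
    using inf[OF that] pos[OF that] M0 by (simp add: M_def divide_simps split: if_splits)
  \<comment> \<open>So close to 1 that \<open>diff\<close> and the bound \<open>M\<close> give at
    most 1/8 between radius \<open>r\<close> and radius 1.\<close>
  define r where "r = 1 - min (1/2) (1 / (8 * M\<^sup>2))"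
  have r: "1/2 \<le> r" "r < 1" "(1 - r) * M\<^sup>2 \<le> 1/8"
  proof -
    have "min (1/2) (1 / (8 * M\<^sup>2)) * M\<^sup>2 \<le> (1 / (8 * M\<^sup>2)) * M\<^sup>2"
      by (intro mult_right_mono) auto
    then show "(1 - r) * M\<^sup>2 \<le> 1/8" using M0 by (simp add: r_def)
  qed (use M0 in \<open>auto simp: r_def\<close>)
  \<comment> \<open>The bound 1/8 is the same for every \<open>m\<close>: averaging two pairs of
    inverses does not enlarge it.\<close>
  have main: "\<exists>y y'. inverse_pair (1 - cscale z (h ^ (2 ^ m))) y \<and>
      inverse_pair (1 - cscale (complex_of_real (r ^ (2 ^ m)) * z) (h ^ (2 ^ m))) y' \<and>
      norm (y - y') \<le> 1/8" if "cmod z = 1" for z m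
    using that
  proof (induction m arbitrary: z)
    case 0
    then have in1: "z \<in> cball 0 1" and in2: "complex_of_real r * z \<in> cball 0 1"
      using r by (auto simp: norm_mult)
    have "dist z (complex_of_real r * z) = 1 - r"
    proof -
      have "z - complex_of_real r * z = complex_of_real (1 - r) * z"
        by (simp add: algebra_simps)
      then show ?thesis using 0 r by (simp only: dist_norm norm_mult norm_of_real) simp
    qed
    then have "norm (E z - E (complex_of_real r * z)) \<le>
        norm (E z) * norm (E (complex_of_real r * z)) * (1 - r)"
      using diff[OF in1 in2] by simp
    also have "\<dots> \<le> M * M * (1 - r)"
      using M[OF in1] M[OF in2] M0 r by (intro mult_mono) auto
    also have "\<dots> \<le> 1/8" using r(3) by (simp add: power2_eq_square mult_ac)
    finally show ?case using E[OF in1] E[OF in2] by auto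
  next
    case (Suc m)
    define k where "k = h ^ (2 ^ m)"
    \<comment> \<open>\<open>1 - z k^2\<close> factors as \<open>(1 - w k) (1 + w k)\<close>, and
      \<open>w\<close> and \<open>- w\<close> both lie on the circle.\<close>
    define w where "w = csqrt z"
    have zw: "z = w * w" by (simp add: w_def flip: power2_eq_square)
    have cw: "cmod w = 1"
    proof -
      have "cmod w * cmod w = 1" using Suc.prems unfolding zw by (simp add: norm_mult)
      then show ?thesis using norm_ge_zero[of w] by (auto simp: square_eq_1_iff)
    qed
    have kk: "h ^ (2 ^ Suc m) = k * k"
      by (simp add: k_def power_add mult_2)
    have rr: "r ^ (2 ^ Suc m) = r ^ (2 ^ m) * r ^ (2 ^ m)"
      by (simp add: power_add mult_2)
    let ?s = "complex_of_real (r ^ (2 ^ m))"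
    from Suc.IH[OF cw] obtain y1 y1' where
      1: "inverse_pair (1 - cscale w k) y1" "inverse_pair (1 - cscale (?s * w) k) y1'"
         "norm (y1 - y1') \<le> 1/8" unfolding k_def by blast
    from Suc.IH[of "- w"] cw obtain y2 y2' where
      2: "inverse_pair (1 - cscale (- w) k) y2" "inverse_pair (1 - cscale (?s * - w) k) y2'"
         "norm (y2 - y2') \<le> 1/8" unfolding k_def by auto
    have "inverse_pair (1 - cscale w k * cscale w k) ((1/2) *\<^sub>R (y1 + y2))"
      using 1(1) 2(1) by (intro inverse_pair_difference_of_squares) (simp_all add: cscale_minus_left)
    moreover have "inverse_pair (1 - cscale (?s * w) k * cscale (?s * w) k)
        ((1/2) *\<^sub>R (y1' + y2'))"
      using 1(2) 2(2) by (intro inverse_pair_difference_of_squares) (simp_all add: cscale_minus_left)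
    moreover have "norm ((1/2) *\<^sub>R (y1 + y2) - (1/2) *\<^sub>R (y1' + y2')) \<le> 1/8"
    proof -
      have "(1/2) *\<^sub>R (y1 + y2) - (1/2) *\<^sub>R (y1' + y2')
          = (1/2) *\<^sub>R ((y1 - y1') + (y2 - y2'))"
        by (simp add: algebra_simps)
      then show ?thesis using 1(3) 2(3) norm_triangle_ineq[of "y1 - y1'" "y2 - y2'"] by simp
    qed
    ultimately show ?case
      unfolding kk rr zw
      by (intro exI[of _ "(1/2) *\<^sub>R (y1 + y2)"] exI[of _ "(1/2) *\<^sub>R (y1' + y2')"])
        (simp add: mult_ac)
  qed
  have "(\<lambda>m. r ^ m) \<longlonglongrightarrow> 0" using r by (intro LIMSEQ_realpow_zero) auto
  then have "\<forall>\<^sub>F m in sequentially. r ^ m < 1/16"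
    by (rule order_tendstoD) simp
  then obtain m where m: "r ^ m < 1/16" by (auto simp: eventually_sequentially)
  \<comment> \<open>As \<open>s\<close> is at most 1/16, \<open>y'\<close> is within 1/8 of 1 and
    hence \<open>y\<close> within 1/4; then \<open>k = (1 - k) * (y - 1)\<close> has norm at most
    1/2, not 1.\<close>
  define s where "s = r ^ (2 ^ m)"
  define k where "k = h ^ (2 ^ m)"
  have "s \<le> r ^ m" unfolding s_def using r
    by (intro power_decreasing) (auto simp: less_imp_le)
  with m have "s \<le> 1/16" by linarith
  moreover have "s \<ge> 0" using r by (simp add: s_def)
  ultimately have s: "s \<le> 1/16" "s \<ge> 0" .
  from main[of 1 m] obtain y y' where y: "inverse_pair (1 - k) y"
    and y': "inverse_pair (1 - cscale (complex_of_real s) k) y'" and yy': "norm (y - y') \<le> 1/8"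
    by (auto simp: s_def k_def)
  have nk: "norm k = 1" using h by (simp add: k_def)
  have e: "y' - 1 = s *\<^sub>R (k * y')"
  proof -
    have "(1 - cscale (complex_of_real s) k) * y' = 1" using y' by (simp add: inverse_pair_def)
    then show ?thesis by (simp add: algebra_simps cscale_of_real)
  qed
  have "norm (y' - 1) \<le> s * norm y'"
    unfolding e using s norm_mult_ineq[of k y'] nk by (simp add: mult_left_mono)
  moreover have "s * norm y' \<le> (1/16) * norm y'" using s by (intro mult_right_mono) auto
  moreover have "norm y' \<le> norm (y' - 1) + 1" using norm_triangle_ineq[of "y' - 1" 1] by simp
  ultimately have "norm (y' - 1) \<le> 1/8" by linarith
  then have y1: "norm (y - 1) \<le> 1/4"
    using yy' norm_triangle_ineq[of "y - y'" "y' - 1"] by simp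
  have "(1 - k) * y = 1" using y by (simp add: inverse_pair_def)
  then have "k = (1 - k) * (y - 1)" by (simp add: algebra_simps)
  then have "norm k \<le> norm (1 - k) * norm (y - 1)" by (metis norm_mult_ineq)
  also have "\<dots> \<le> 2 * (1/4)"
    using y1 norm_triangle_ineq4[of 1 k] nk by (intro mult_mono) auto
  finally show False using nk by simp
qed

text \<open>Iterated C*-identity. For \<open>x\<close> of norm 1 it supplies the hypothesis of
  \<open>ex_not_invertible_on_circle\<close>.\<close>

lemma norm_selfadjoint_power_two:
  assumes "cstar x = (x::'a::cstar_algebra)"
  shows "cstar (x ^ (2 ^ m)) = x ^ (2 ^ m) \<and> norm (x ^ (2 ^ m)) = norm x ^ (2 ^ m)"
proof (induction m)
  case (Suc m)
  have "x ^ (2 ^ Suc m) = x ^ (2 ^ m) * x ^ (2 ^ m)" by (simp add: power_add mult_2)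
  then show ?case
    using Suc norm_selfadjoint_square[of "x ^ (2 ^ m)"]
    by (simp add: cstar_mult power2_eq_square power_add mult_2)
qed (simp add: assms)

text \<open>After scaling to norm 1, some spectral point has modulus \<open>norm x\<close>; since
  the spectrum is real, only two candidates remain.\<close>

lemma norm_in_cspectrum:
  assumes sa: "cstar x = (x::'a::cstar_algebra)"
  shows "complex_of_real (norm x) \<in> cspectrum x \<or> - complex_of_real (norm x) \<in> cspectrum x"
proof (cases "x = 0")
  case True
  then show ?thesis by (auto simp: mem_cspectrum_iff inverse_pair_def)
next
  case False
  define h where "h = (1 / norm x) *\<^sub>R x"
  have sah: "cstar h = h" by (simp add: h_def cstar_scaleR sa)
  have nh: "norm h = 1" using False by (simp add: h_def)
  have "\<And>m. norm (h ^ (2 ^ m)) = 1"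
    using norm_selfadjoint_power_two[OF sah] nh by simp
  from ex_not_invertible_on_circle[OF this] obtain z where
    z: "cmod z = 1" "\<not> (\<exists>y. inverse_pair (1 - cscale z h) y)" by blast
  have z0: "z \<noteq> 0" using z by auto
  let ?c = "complex_of_real (norm x) / z"
  have "cscale z h = cscale (1 / ?c) x"
    using z0 False by (simp add: h_def flip: cscale_of_real)
  then have c: "?c \<in> cspectrum x"
    using z z0 False by (subst mem_cspectrum_iff') auto
  have "cmod ?c = norm x" using z by (simp add: norm_divide)
  moreover have "?c = complex_of_real (Re ?c)" by (rule cspectrum_selfadjoint_real[OF sa c])
  ultimately have "\<bar>Re ?c\<bar> = norm x" by (metis norm_of_real)
  then have "Re ?c = norm x \<or> Re ?c = - norm x" by linarith
  then show ?thesis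
    using c \<open>?c = complex_of_real (Re ?c)\<close> by (metis of_real_minus)
qed

section \<open>Positive elements\<close>

lemma cpositive_cstar: "cpositive x \<Longrightarrow> cstar x = x"
  by (simp add: cpositive_def)

text \<open>Passing to \<open>s - x\<close> reflects the spectrum, and a selfadjoint element attains
  its norm there up to sign. Positivity thus becomes a norm inequality, which behaves well under
  sums and limits.\<close>

lemma cpositive_iff_norm_le:
  fixes x :: "'a::cstar_algebra"
  assumes s: "norm x \<le> s"
  shows "cpositive x \<longleftrightarrow> cstar x = x \<and> norm (s *\<^sub>R 1 - x) \<le> s"
proof -
  define b where "b = s *\<^sub>R 1 - x"
  have b: "b = - x + cscale (complex_of_real s) 1" by (simp add: b_def cscale_of_real)
  have spec: "c \<in> cspectrum b \<longleftrightarrow> complex_of_real s - c \<in> cspectrum x" for c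
    by (simp only: b cspectrum_shift cspectrum_minus) simp
  have "norm b \<le> s" if pos: "cpositive x"
  proof -
    have "cstar b = b" using pos by (simp add: b_def cstar_diff cstar_scaleR cpositive_cstar)
    from norm_in_cspectrum[OF this]
    have "complex_of_real (s - norm b) \<in> cspectrum x \<or> complex_of_real (s + norm b) \<in> cspectrum x"
      by (simp add: spec)
    then show ?thesis
    proof
      assume "complex_of_real (s - norm b) \<in> cspectrum x"
      then have "complex_of_real (s - norm b) \<in> complex_of_real ` {0..}"
        using pos unfolding cpositive_def by blast
      then show ?thesis by (auto simp: image_iff simp del: of_real_diff)
    next
      \<comment> \<open>This point violates the norm bound on the spectrum of \<open>x\<close>
        unless \<open>b = 0\<close>.\<close>
      assume "complex_of_real (s + norm b) \<in> cspectrum x"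
      then have "\<bar>s + norm b\<bar> \<le> norm x"
        using cspectrum_norm_le by (metis norm_of_real)
      then show ?thesis using s norm_ge_zero[of b] norm_ge_zero[of x] by linarith
    qed
  qed
  moreover have "cpositive x" if sa: "cstar x = x" and le: "norm b \<le> s"
    unfolding cpositive_def
  proof (intro conjI sa subsetI)
    fix c assume c: "c \<in> cspectrum x"
    then have re: "c = complex_of_real (Re c)" by (rule cspectrum_selfadjoint_real[OF sa])
    have "complex_of_real s - c \<in> cspectrum b" using c by (simp add: spec)
    then have "cmod (complex_of_real s - c) \<le> s" using cspectrum_norm_le le by fastforce
    then have "\<bar>s - Re c\<bar> \<le> s" by (subst (asm) re) (simp flip: of_real_diff)
    then have "Re c \<in> {0..}" by auto
    then show "c \<in> complex_of_real ` {0..}" using re by blast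
  qed
  ultimately show ?thesis using cpositive_cstar unfolding b_def by blast
qed

lemma cpositive_0 [simp]: "cpositive (0::'a::cstar_algebra)"
  using cpositive_iff_norm_le[of "0::'a" 0] by simp

text \<open>Triangle inequality in the norm criterion, with
  \<open>s = norm x + norm y\<close>.\<close>

lemma cpositive_add:
  assumes "cpositive x" "cpositive (y::'a::cstar_algebra)"
  shows "cpositive (x + y)"
proof -
  have "norm (norm x *\<^sub>R 1 - x) \<le> norm x" "norm (norm y *\<^sub>R 1 - y) \<le> norm y"
    using assms cpositive_iff_norm_le by blast+
  then have "norm ((norm x *\<^sub>R 1 - x) + (norm y *\<^sub>R 1 - y)) \<le> norm x + norm y"
    using norm_triangle_mono by blast
  moreover have "(norm x *\<^sub>R 1 - x) + (norm y *\<^sub>R 1 - y) = (norm x + norm y) *\<^sub>R 1 - (x + y)"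
    by (simp add: algebra_simps)
  ultimately have "norm ((norm x + norm y) *\<^sub>R 1 - (x + y)) \<le> norm x + norm y"
    by simp
  then show ?thesis
    using assms by (simp add: cpositive_iff_norm_le[OF norm_triangle_ineq] cstar_add cpositive_cstar)
qed

lemma cpositive_scaleR:
  assumes "cpositive (x::'a::cstar_algebra)" "r \<ge> 0"
  shows "cpositive (r *\<^sub>R x)"
proof -
  have "norm (norm x *\<^sub>R 1 - x) \<le> norm x"
    using assms(1) cpositive_iff_norm_le by blast
  then have "norm (r *\<^sub>R (norm x *\<^sub>R 1 - x)) \<le> r * norm x"
    using assms(2) by (simp add: mult_left_mono)
  moreover have "r *\<^sub>R (norm x *\<^sub>R 1 - x) = (r * norm x) *\<^sub>R 1 - r *\<^sub>R x"
    by (simp add: algebra_simps)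
  moreover have "norm (r *\<^sub>R x) \<le> r * norm x" using assms(2) by simp
  ultimately show ?thesis
    using assms(1) by (simp add: cpositive_iff_norm_le cstar_scaleR cpositive_cstar)
qed

text \<open>With \<open>s = norm x\<close> the norm criterion is a closed condition.\<close>

lemma cpositive_limit:
  fixes f :: "nat \<Rightarrow> 'a::cstar_algebra"
  assumes pos: "\<And>n. cpositive (f n)" and lim: "f \<longlonglongrightarrow> l"
  shows "cpositive l"
proof -
  have "(\<lambda>n. cstar (f n)) \<longlonglongrightarrow> cstar l" using lim by (rule tendsto_cstar)
  then have "f \<longlonglongrightarrow> cstar l" using pos by (simp add: cpositive_cstar)
  then have "cstar l = l" using lim LIMSEQ_unique by blast
  moreover have "norm (norm l *\<^sub>R 1 - l) \<le> norm l"
  proof (rule LIMSEQ_le)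
    show "(\<lambda>n. norm (norm (f n) *\<^sub>R 1 - f n)) \<longlonglongrightarrow> norm (norm l *\<^sub>R 1 - l)"
      by (intro tendsto_intros lim)
    show "(\<lambda>n. norm (f n)) \<longlonglongrightarrow> norm l" by (intro tendsto_intros lim)
    show "\<exists>N. \<forall>n\<ge>N. norm (norm (f n) *\<^sub>R 1 - f n) \<le> norm (f n)"
      using pos cpositive_iff_norm_le by blast
  qed
  ultimately show ?thesis using cpositive_iff_norm_le by blast
qed

lemma selfadjoint_eq_0_if_cspectrum:
  assumes "cstar x = (x::'a::cstar_algebra)" "cspectrum x \<subseteq> {0}"
  shows "x = 0"
  using norm_in_cspectrum[OF assms(1)] assms(2) by auto

lemma cpositive_antisym:
  assumes "cpositive x" "cpositive (- (x::'a::cstar_algebra))"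
  shows "x = 0"
proof (rule selfadjoint_eq_0_if_cspectrum)
  show "cspectrum x \<subseteq> {0}"
  proof
    fix c assume c: "c \<in> cspectrum x"
    then have "- c \<in> cspectrum (- x)" by (simp add: cspectrum_minus)
    with assms c have "c \<in> complex_of_real ` {0..}" "- c \<in> complex_of_real ` {0..}"
      unfolding cpositive_def by blast+
    then have "Re c \<ge> 0" "Re c \<le> 0" "Im c = 0" by force+
    then show "c \<in> {0}" by (simp add: complex_eq_iff)
  qed
qed (rule cpositive_cstar[OF assms(1)])

text \<open>For \<open>c = - (t * t)\<close> with \<open>t > 0\<close>, \<open>h * h - c\<close>
  factors into \<open>h + i t\<close> and \<open>h - i t\<close>, both invertible because the
  spectrum of \<open>h\<close> is real.\<close>

lemma cpositive_selfadjoint_square: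
  assumes sa: "cstar h = (h::'a::cstar_algebra)"
  shows "cpositive (h * h)"
  unfolding cpositive_def
proof (intro conjI subsetI)
  show sa2: "cstar (h * h) = h * h" by (simp add: cstar_mult sa)
  fix c assume c: "c \<in> cspectrum (h * h)"
  then have re: "c = complex_of_real (Re c)" by (rule cspectrum_selfadjoint_real[OF sa2])
  have "Re c \<ge> 0"
  proof (rule ccontr)
    assume "\<not> Re c \<ge> 0"
    define t where "t = sqrt (- Re c)"
    have t: "t > 0" "t * t = - Re c" using \<open>\<not> Re c \<ge> 0\<close> by (simp_all add: t_def)
    define a where "a = cscale (\<i> / t) h"
    have inv: "\<exists>y. inverse_pair (1 - cscale (1/d) h) y" if "Im d \<noteq> 0" for d
    proof -
      have "d \<notin> cspectrum h"
        using that cspectrum_selfadjoint_real[OF sa] by (metis Im_complex_of_real)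
      moreover have "d \<noteq> 0" using that by auto
      ultimately show ?thesis by (simp add: mem_cspectrum_iff')
    qed
    have "\<exists>y. inverse_pair (1 - a) y"
      using inv[of "- \<i> * t"] t by (simp add: a_def divide_inverse mult_ac)
    moreover have "\<exists>y. inverse_pair (1 + a) y"
      using inv[of "\<i> * t"] t by (simp add: a_def divide_inverse mult_ac cscale_minus_left)
    ultimately have "\<exists>y. inverse_pair (1 - a * a) y"
      using inverse_pair_difference_of_squares by blast
    moreover have "a * a = cscale (1/c) (h * h)"
    proof -
      have "c = - (complex_of_real t * complex_of_real t)"
        by (subst re) (simp add: t flip: of_real_mult)
      then show ?thesis by (simp add: a_def)
    qed
    moreover have "c \<noteq> 0" using \<open>\<not> Re c \<ge> 0\<close> by auto
    ultimately show False using c by (simp add: mem_cspectrum_iff')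
  qed
  then show "c \<in> complex_of_real ` {0..}" using re by auto
qed

section \<open>Square roots and the absolute value\<close>

text \<open>The iteration \<open>y \<mapsto> (x + y\<^sup>2) / 2\<close> for \<open>1 - sqrt (1 - x)\<close>; its increments are dominated
  by those of the scalar iteration with \<open>x = 1\<close>.\<close>
lemma ex_sqrt_norm_le_1:
  fixes a :: "'a::cstar_algebra"
  assumes pos: "cpositive a" and a1: "norm a \<le> 1"
  shows "\<exists>r. cpositive r \<and> r * r = a \<and> (\<forall>y. y * a = a * y \<longrightarrow> y * r = r * y)"
proof -
  define x where "x = 1 - a"
  have sax: "cstar x = x" using pos by (simp add: x_def cstar_diff cpositive_cstar)
  have x1: "norm x \<le> 1" using pos cpositive_iff_norm_le[OF a1] by (simp add: x_def)
  define Y where "Y n = ((\<lambda>y. (1/2) *\<^sub>R (x + y * y)) ^^ n) 0" for n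
  define T where "T n = ((\<lambda>t. (1/2) * (1 + t * t)) ^^ n) (0::real)" for n
  have Y0: "Y 0 = 0" and YS: "Y (Suc n) = (1/2) *\<^sub>R (x + Y n * Y n)" for n
    by (simp_all add: Y_def)
  have T0: "T 0 = 0" and TS: "T (Suc n) = (1/2) * (1 + T n * T n)" for n
    by (simp_all add: T_def)
  have T: "0 \<le> T n \<and> T n \<le> 1" for n
    by (induction n) (auto simp: T0 TS mult_le_one)
  \<comment> \<open>The increment is \<open>(T n - 1) ^ 2 / 2\<close>.\<close>
  have Tinc: "T n \<le> T (Suc n)" for n
    using zero_le_square[of "T n - 1"] by (simp add: TS algebra_simps)
  have comm: "y * Y n = Y n * y" if "y * x = x * y" for y n
  proof (induction n)
    case (Suc n)
    have "y * (Y n * Y n) = Y n * Y n * y" by (metis Suc mult.assoc)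
    then show ?case by (simp add: YS distrib_left distrib_right that)
  qed (simp add: Y0)
  have commY: "Y m * Y n = Y n * Y m" for m n
    using comm[of x m] comm[of "Y m" n] by simp
  have saY: "cstar (Y n) = Y n" for n
    by (induction n) (simp_all add: Y0 YS cstar_scaleR cstar_add cstar_mult sax)
  have nY: "norm (Y n) \<le> T n" for n
  proof (induction n)
    case (Suc n)
    have "norm (Y n * Y n) \<le> T n * T n"
      using Suc norm_mult_ineq[of "Y n" "Y n"] mult_mono[OF Suc Suc] T[of n] by simp
    then show ?case
      using norm_triangle_ineq[of x "Y n * Y n"] x1 by (simp add: YS TS)
  qed (simp add: Y0 T0)
  have step: "norm (Y (Suc n) - Y n) \<le> T (Suc n) - T n" for n
  proof (induction n)
    case 0
    then show ?case using x1 by (simp add: Y0 T0 YS TS)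
  next
    case (Suc n)
    \<comment> \<open>The difference of squares factors only because the iterates commute.\<close>
    have "(1/2) *\<^sub>R (x + a * a) - (1/2) *\<^sub>R (x + b * b) = (1/2) *\<^sub>R ((a - b) * (a + b))"
      if "a * b = b * a" for a b :: 'a
      by (simp add: algebra_simps that)
    from trans[OF arg_cong2[where f = minus, OF YS YS] this[OF commY]]
    have "Y (Suc (Suc n)) - Y (Suc n)
        = (1/2) *\<^sub>R ((Y (Suc n) - Y n) * (Y (Suc n) + Y n))" .
    also have "norm \<dots> \<le> (1/2) * (norm (Y (Suc n) - Y n) * norm (Y (Suc n) + Y n))"
      by (simp add: norm_mult_ineq)
    also have "\<dots> \<le> (1/2) * ((T (Suc n) - T n) * (T (Suc n) + T n))"
      using Suc nY[of n] nY[of "Suc n"] norm_triangle_ineq[of "Y (Suc n)" "Y n"] Tinc[of n]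
      by (intro mult_left_mono mult_mono) auto
    also have "\<dots> = T (Suc (Suc n)) - T (Suc n)"
      using arg_cong2[where f = minus, OF TS[of "Suc n"] TS[of n]] by (simp add: algebra_simps)
    finally show ?case .
  qed
  have tele: "norm (Y (n + k) - Y n) \<le> T (n + k) - T n" for n k
  proof (induction k)
    case (Suc k)
    then show ?case
      using step[of "n + k"] norm_triangle_ineq[of "Y (Suc (n + k)) - Y (n + k)" "Y (n + k) - Y n"]
      by simp
  qed simp
  have "convergent T"
    using T Tinc by (intro Bseq_monoseq_convergent BseqI'[of _ 1] incseq_imp_monoseq incseq_SucI) auto
  then have cT: "Cauchy T" by (rule convergent_Cauchy)
  have "Cauchy Y"
  proof (rule CauchyI)
    fix e :: real assume "e > 0"
    then obtain M where M: "\<And>m n. m \<ge> M \<Longrightarrow> n \<ge> M \<Longrightarrow> norm (T m - T n) < e"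
      using cT by (meson CauchyD)
    have *: "norm (Y m - Y n) < e" if "m \<ge> n" "n \<ge> M" for m n
      using tele[of n "m - n"] M[of m n] that by simp
    have "norm (Y m - Y n) < e" if "m \<ge> M" "n \<ge> M" for m n
      using *[of m n] *[of n m] that by (cases "m \<ge> n") (auto simp: norm_minus_commute)
    then show "\<exists>M. \<forall>m\<ge>M. \<forall>n\<ge>M. norm (Y m - Y n) < e" by blast
  qed
  then obtain L where L: "Y \<longlonglongrightarrow> L" using Cauchy_convergent convergent_def by blast
  have "(\<lambda>n. Y (Suc n)) \<longlonglongrightarrow> (1/2) *\<^sub>R (x + L * L)"
    unfolding YS by (intro tendsto_intros L)
  then have eq: "L = (1/2) *\<^sub>R (x + L * L)"
    using LIMSEQ_Suc[OF L] LIMSEQ_unique by blast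
  have saL: "cstar L = L"
    using tendsto_cstar[OF L] L saY LIMSEQ_unique by auto
  have nL: "norm L \<le> 1"
    using tendsto_norm[OF L] by (rule LIMSEQ_le_const2) (use nY T order_trans in blast)
  \<comment> \<open>The fixed point equation for \<open>L\<close> says that
    \<open>(1 - L)^2 = 1 - x = a\<close>.\<close>
  define r where "r = 1 - L"
  have "2 *\<^sub>R L = x + L * L" by (subst eq) simp
  then have "r * r = a" by (simp add: r_def x_def algebra_simps scaleR_2)
  moreover have "cpositive r"
  proof -
    have "norm r \<le> 2" using norm_triangle_ineq4[of 1 L] nL by (simp add: r_def)
    moreover have "2 *\<^sub>R 1 - r = 1 + L" by (simp only: r_def scaleR_2) simp
    then have "norm (2 *\<^sub>R 1 - r) \<le> 2"
      using norm_triangle_ineq[of 1 L] nL by simp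
    moreover have "cstar r = r" by (simp add: r_def cstar_diff saL)
    ultimately show ?thesis using cpositive_iff_norm_le by blast
  qed
  moreover have "y * r = r * y" if "y * a = a * y" for y
  proof -
    have "y * x = x * y" using that by (simp add: x_def algebra_simps)
    then have "(\<lambda>n. y * Y n) = (\<lambda>n. Y n * y)" using comm by blast
    moreover have "(\<lambda>n. y * Y n) \<longlonglongrightarrow> y * L" "(\<lambda>n. Y n * y) \<longlonglongrightarrow> L * y"
      by (intro tendsto_intros L)+
    ultimately have "y * L = L * y" using LIMSEQ_unique by metis
    then show ?thesis by (simp add: r_def algebra_simps)
  qed
  ultimately show ?thesis by blast
qed

lemma ex_sqrt:
  fixes a :: "'a::cstar_algebra"
  assumes pos: "cpositive a"
  shows "\<exists>r. cpositive r \<and> r * r = a \<and> (\<forall>y. y * a = a * y \<longrightarrow> y * r = r * y)"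
proof (cases "a = 0")
  case True
  then show ?thesis by (intro exI[of _ 0]) simp
next
  case False
  define b where "b = (1 / norm a) *\<^sub>R a"
  have "cpositive b" "norm b \<le> 1" using False pos by (simp_all add: b_def cpositive_scaleR)
  from ex_sqrt_norm_le_1[OF this] obtain s where s: "cpositive s" "s * s = b"
    "\<And>y. y * b = b * y \<Longrightarrow> y * s = s * y" by blast
  define r where "r = sqrt (norm a) *\<^sub>R s"
  have "r * r = a" using False by (simp add: r_def s b_def)
  moreover have "cpositive r" using s(1) by (simp add: r_def cpositive_scaleR)
  moreover have "y * r = r * y" if "y * a = a * y" for y
    using s(3)[of y] that by (simp add: r_def b_def)
  ultimately show ?thesis by blast
qed

text \<open>\<open>x * x\<close> is positive, and so is its negative \<open>y * y\<close>.\<close>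

lemma sum_squares_eq_0:
  assumes "cstar x = x" "cstar y = y" "x * x + y * y = (0::'a::cstar_algebra)"
  shows "x = 0"
proof -
  have "- (x * x) = y * y" using assms(3) by (rule minus_unique)
  then have "cpositive (- (x * x))" by (simp only: cpositive_selfadjoint_square[OF assms(2)])
  with cpositive_selfadjoint_square[OF assms(1)] have "x * x = 0" by (rule cpositive_antisym)
  with assms(1) show ?thesis by (rule selfadjoint_square_eq_0)
qed

text \<open>For commuting roots with difference \<open>d\<close>, the elements \<open>d u d\<close>
  and \<open>d v d\<close> are squares with sum 0, so both vanish and \<open>d^3 = 0\<close>. In
  general \<open>r\<close> and \<open>s\<close> are each compared with the root from
  \<open>ex_sqrt\<close>, which commutes with both.\<close>

lemma sqrt_unique:
  fixes r s :: "'a::cstar_algebra"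
  assumes r: "cpositive r" and s: "cpositive s" and eq: "r * r = s * s"
  shows "r = s"
proof -
  have unique: "u = v" if u: "cpositive u" and v: "cpositive v" and eq: "u * u = v * v"
    and comm: "u * v = v * u" for u v :: 'a
  proof -
    define d where "d = u - v"
    have sa: "cstar d = d" using u v by (simp add: d_def cstar_diff cpositive_cstar)
    obtain p where p: "cpositive p" "p * p = u" "\<And>y. y * u = u * y \<Longrightarrow> y * p = p * y"
      using ex_sqrt[OF u] by blast
    obtain q where q: "cpositive q" "q * q = v" "\<And>y. y * v = v * y \<Longrightarrow> y * q = q * y"
      using ex_sqrt[OF v] by blast
    have "d * u = u * d" "d * v = v * d"
      by (simp_all add: d_def algebra_simps comm)
    then have dp: "d * p = p * d" and dq: "d * q = q * d"
      using p(3) q(3) by blast+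
    have sq: "(d * t) * (d * t) = d * (t * t) * d" if "d * t = t * d" for t
    proof -
      have "(d * t) * (d * t) = (d * t) * (t * d)" by (simp only: that)
      then show ?thesis by (simp only: mult.assoc)
    qed
    have "(d * p) * (d * p) = d * u * d" using sq[OF dp] by (simp only: p(2))
    moreover have "(d * q) * (d * q) = d * v * d" using sq[OF dq] by (simp only: q(2))
    moreover have dd: "d * u * d + d * v * d = 0"
    proof -
      have "(u + v) * d = 0" by (simp add: d_def algebra_simps eq comm)
      moreover have "d * u * d + d * v * d = d * ((u + v) * d)" by (simp add: algebra_simps)
      ultimately show ?thesis by simp
    qed
    ultimately have "(d * p) * (d * p) + (d * q) * (d * q) = 0" by simp
    moreover have "cstar (d * p) = d * p" "cstar (d * q) = d * q"
      by (simp_all only: cstar_mult sa cpositive_cstar[OF p(1)] cpositive_cstar[OF q(1)] dp dq)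
    ultimately have "d * p = 0" by (intro sum_squares_eq_0[of "d * p" "d * q"])
    then have "d * u * d = 0" using \<open>(d * p) * (d * p) = d * u * d\<close> by simp
    with dd have "d * v * d = 0" by simp
    have "d * d * d = d * u * d - d * v * d"
      by (subst (2) d_def) (simp add: algebra_simps)
    then have "d * d * d = 0" using \<open>d * u * d = 0\<close> \<open>d * v * d = 0\<close> by simp
    with sa have "d = 0" by (rule selfadjoint_cube_eq_0)
    then show ?thesis by (simp add: d_def)
  qed
  have "cpositive (s * s)" using s by (intro cpositive_selfadjoint_square cpositive_cstar)
  from ex_sqrt[OF this] obtain t where t: "cpositive t" "t * t = s * s"
    "\<And>y. y * (s * s) = s * s * y \<Longrightarrow> y * t = t * y" by blast
  have "s * t = t * s" by (rule t(3)) (simp add: mult.assoc)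
  then have "s = t" by (rule unique[OF s t(1) t(2)[symmetric]])
  have "r * t = t * r" by (rule t(3)) (simp add: mult.assoc flip: eq)
  then have "r = t" by (rule unique[OF r t(1) trans[OF eq t(2)[symmetric]]])
  with \<open>s = t\<close> show ?thesis by simp
qed

text \<open>Let \<open>k = |h|\<close> and \<open>u = k - h\<close> for \<open>h = x\<^sup>* x\<close>, and \<open>y = x u\<close>. Then \<open>y\<^sup>* y = - u k u\<close> is
  negative, hence so is \<open>y y\<^sup>*\<close>, whereas \<open>y\<^sup>* y + y y\<^sup>*\<close> is a sum of squares; so \<open>y = 0\<close>.\<close>
lemma cpositive_cstar_mult:
  fixes x :: "'a::cstar_algebra"
  shows "cpositive (cstar x * x)"
proof -
  define h where "h = cstar x * x"
  have sah: "cstar h = h" by (simp add: h_def cstar_mult cstar_cstar)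
  obtain k where k: "cpositive k" "k * k = h * h" "\<And>y. y * (h * h) = h * h * y \<Longrightarrow> y * k = k * y"
    using ex_sqrt[OF cpositive_selfadjoint_square[OF sah]] by blast
  have hk: "h * k = k * h" by (rule k(3)) (simp add: mult.assoc)
  define u where "u = k - h"
  have sau: "cstar u = u" using k(1) by (simp add: u_def cstar_diff sah cpositive_cstar)
  obtain m where m: "cpositive m" "m * m = k" "\<And>y. y * k = k * y \<Longrightarrow> y * m = m * y"
    using ex_sqrt[OF k(1)] by blast
  have um: "u * m = m * u" by (rule m(3)) (simp add: u_def algebra_simps hk)
  define y where "y = x * u"
  have yy: "cstar y * y = - ((m * u) * (m * u))"
  proof -
    have "h * u = - (k * u)" by (simp add: u_def algebra_simps hk k(2))
    moreover have "cstar y * y = u * (h * u)"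
      by (simp add: y_def h_def cstar_mult sau mult.assoc)
    ultimately have "cstar y * y = - (u * (m * m) * u)" by (simp add: m(2) mult.assoc)
    also have "u * (m * m) * u = (u * m) * (m * u)" by (simp only: mult.assoc)
    finally show ?thesis by (simp only: um)
  qed
  have "cpositive ((m * u) * (m * u))"
    using um sau m(1) by (intro cpositive_selfadjoint_square) (simp add: cstar_mult cpositive_cstar)
  then have neg: "cpositive (- (cstar y * y))" by (simp add: yy)
  have neg': "cpositive (- (y * cstar y))"
    unfolding cpositive_def
  proof (intro conjI subsetI)
    show "cstar (- (y * cstar y)) = - (y * cstar y)"
      by (simp add: cstar_minus cstar_mult cstar_cstar)
    fix c assume c: "c \<in> cspectrum (- (y * cstar y))"
    show "c \<in> complex_of_real ` {0..}"
    proof (cases "c = 0")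
      case False
      then have "c \<in> cspectrum (- (cstar y * y))"
        using c cspectrum_mult_commute[of "- c" y "cstar y"] by (simp add: cspectrum_minus)
      then show ?thesis using neg unfolding cpositive_def by blast
    qed simp
  qed
  \<comment> \<open>Up to factors, the real and imaginary parts of \<open>y\<close>; their squares
    add up to twice \<open>cstar y * y + y * cstar y\<close>.\<close>
  define a where "a = y + cstar y"
  define b where "b = cscale \<i> (y - cstar y)"
  have sab: "cstar a = a" "cstar b = b"
    by (simp_all add: a_def b_def cstar_add cstar_diff cstar_cstar cstar_cscale
        cscale_minus_left cscale_diff_right add.commute)
  have "a * a + b * b = 2 *\<^sub>R (cstar y * y + y * cstar y)"
    by (simp add: a_def b_def cscale_minus_left cscale_diff_right scaleR_2 algebra_simps)
  then have "cstar y * y = (1/2) *\<^sub>R (a * a + b * b) + - (y * cstar y)" by simp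
  moreover have "cpositive \<dots>"
    by (rule cpositive_add[OF cpositive_scaleR[OF cpositive_add] neg'])
      (simp_all add: sab cpositive_selfadjoint_square)
  ultimately have "cpositive (cstar y * y)" by simp
  with neg have "cstar y * y = 0" using cpositive_antisym by blast
  then have y0: "y = 0" by (rule cstar_mult_self_eq_0)
  \<comment> \<open>Now \<open>h u\<close> and \<open>k u\<close> vanish, so
    \<open>u * u = 0\<close> and \<open>h\<close> equals the positive element
    \<open>k\<close>.\<close>
  have "h * u = 0" using y0 by (simp add: h_def y_def mult.assoc)
  moreover have "h * u = - (k * u)" by (simp add: u_def algebra_simps hk k(2))
  moreover have "u * u = k * u - h * u" by (subst u_def) (simp add: algebra_simps)
  ultimately have "u * u = 0" by simp
  with sau have "u = 0" by (rule selfadjoint_square_eq_0)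
  then show ?thesis using k(1) by (simp add: u_def h_def)
qed

text \<open>Existence and uniqueness of the positive root give the \<open>THE\<close> in
  \<open>cabs\<close> its meaning.\<close>

lemma cabs_properties: "cpositive (cabs x) \<and> cabs x * cabs x = cstar (x::'a::cstar_algebra) * x"
proof -
  obtain r where "cpositive r" "r * r = cstar x * x"
    using ex_sqrt[OF cpositive_cstar_mult] by blast
  then have "\<exists>!r. cpositive r \<and> r * r = cstar x * x" using sqrt_unique by metis
  then show ?thesis unfolding cabs_def by (rule theI')
qed

lemma cabs_eqD:
  "cabs x = cabs y \<Longrightarrow> cstar x * x = cstar y * (y::'a::cstar_algebra)"
  by (metis cabs_properties)

lemma cabs_cpositive:
  assumes "cpositive (x::'a::cstar_algebra)"
  shows "cabs x = x"
  using cabs_properties[of x] assms sqrt_unique[of "cabs x" x] by (simp add: cpositive_cstar)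

section \<open>Conjugations in a prime algebra\<close>

text \<open>Since \<open>spec (x y)\<close> and \<open>spec (y x)\<close> agree off \<open>0\<close>, the hypothesis puts the spectrum of
  \<open>(m Z B)\<^sup>* (m Z B)\<close> into both half-lines.\<close>
lemma sylvester_eq_0:
  fixes m Z B :: "'a::cstar_algebra"
  assumes sa: "cstar m = m"
    and eq: "m * m * Z * (B * cstar B) = - (B * cstar B * Z * (m * m))"
  shows "m * m * Z * (B * cstar B) = 0"
proof -
  define w where "w = cstar (m * Z * B) * (m * Z * B)"
  define v where "v = cstar (cstar B * Z * m) * (cstar B * Z * m)"
  have pos: "cpositive w" "cpositive v" by (simp_all only: w_def v_def cpositive_cstar_mult)
  have "cspectrum w \<subseteq> {0}"
  proof (rule subsetI, rule ccontr)
    fix c assume c: "c \<in> cspectrum w" and "c \<notin> {0}"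
    then have c0: "c \<noteq> 0" "- c \<noteq> 0" by auto
    \<comment> \<open>Cycling \<open>cstar B\<close> to the right end, applying \<open>eq\<close>,
      and cycling \<open>m\<close> to the left end turns \<open>w\<close> into
      \<open>- v\<close>.\<close>
    have "w = cstar B * (cstar Z * (m * m * Z * B))"
      by (simp only: w_def cstar_mult sa mult.assoc)
    with c have "c \<in> cspectrum (cstar B * (cstar Z * (m * m * Z * B)))" by simp
    then have "c \<in> cspectrum (cstar Z * (m * m * Z * B) * cstar B)"
      using c0(1) by (rule cspectrum_mult_commute)
    also have "cstar Z * (m * m * Z * B) * cstar B = cstar Z * (m * m * Z * (B * cstar B))"
      by (simp only: mult.assoc)
    also have "\<dots> = - (cstar Z * (B * cstar B * Z * m) * m)"
      by (subst eq) (simp only: mult.assoc mult_minus_right)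
    finally have "- c \<in> cspectrum (cstar Z * (B * cstar B * Z * m) * m)"
      by (simp only: cspectrum_minus)
    then have "- c \<in> cspectrum (m * (cstar Z * (B * cstar B * Z * m)))"
      using c0(2) by (rule cspectrum_mult_commute)
    also have "m * (cstar Z * (B * cstar B * Z * m)) = v"
      by (simp only: v_def cstar_mult cstar_cstar sa mult.assoc)
    finally have "- c \<in> complex_of_real ` {0..}" "c \<in> complex_of_real ` {0..}"
      using pos c unfolding cpositive_def by blast+
    then have "Re c \<le> 0" "Re c \<ge> 0" "Im c = 0" by force+
    with c0 show False by (simp add: complex_eq_iff)
  qed
  with pos(1) have "w = 0" by (intro selfadjoint_eq_0_if_cspectrum cpositive_cstar)
  then have "m * Z * B = 0" unfolding w_def by (rule cstar_mult_self_eq_0)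
  moreover have "m * m * Z * (B * cstar B) = m * (m * Z * B) * cstar B"
    by (simp only: mult.assoc)
  ultimately show ?thesis by simp
qed

text \<open>The hypothesis says that \<open>h\<close> is the multiple of \<open>B B\<^sup>*\<close> by an element of the extended
  centroid. With \<open>u\<close> and \<open>v\<close> twice the positive and negative parts of \<open>h\<close>, primeness is applied
  to \<open>|h| u Y v B B\<^sup>* = 0\<close>.\<close>
lemma prime_sign_dichotomy:
  fixes h B :: "'a::cstar_algebra"
  assumes prime: "prime_ring TYPE('a)" and sa: "cstar h = h" and B: "B \<noteq> 0"
    and comm: "\<And>Y. h * Y * (B * cstar B) = B * cstar B * Y * h"
  shows "cpositive h \<or> cpositive (- h)"
proof -
  have primeD: "x = 0 \<or> y = 0" if "\<And>Y. x * Y * y = 0" for x y :: 'a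
    using prime that unfolding prime_ring_def by blast
  define P where "P = B * cstar B"
  have hP: "h * Y * P = P * Y * h" for Y using comm by (simp only: P_def)
  have P0: "P \<noteq> 0" using B mult_cstar_self_eq_0 by (auto simp: P_def)
  obtain a where a: "cpositive a" "a * a = h * h"
    and a_comm: "\<And>y. y * (h * h) = h * h * y \<Longrightarrow> y * a = a * y"
    using ex_sqrt[OF cpositive_selfadjoint_square[OF sa]] by blast
  have ha: "h * a = a * h" by (rule a_comm) (simp add: mult.assoc)
  obtain m where m: "cpositive m" "m * m = a" using ex_sqrt[OF a(1)] by blast
  define u where "u = a + h"
  define v where "v = a - h"
  have sauv: "cstar u = u" "cstar v = v"
    by (simp_all add: u_def v_def cstar_add cstar_diff sa cpositive_cstar[OF a(1)])
  have hu: "h * u = a * u" by (simp add: u_def algebra_simps a(2) ha)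
  have vh: "v * h = - (v * a)" by (simp add: v_def algebra_simps a(2) ha)
  have "a * u * Y * (v * P) = 0" for Y
  proof -
    \<comment> \<open>Between \<open>u\<close> and \<open>v\<close>, \<open>h\<close> acts as
      \<open>a\<close> from the left and as \<open>- a\<close> from the right, which produces the
      sign in \<open>sylvester_eq_0\<close>.\<close>
    define Z where "Z = u * Y * v"
    have "a * Z * P = h * Z * P" by (simp only: Z_def mult.assoc[symmetric] hu)
    also have "\<dots> = P * Z * h" by (rule hP)
    also have "\<dots> = P * (u * Y) * (v * h)" by (simp only: Z_def mult.assoc)
    also have "\<dots> = - (P * Z * a)" by (simp add: vh Z_def mult.assoc)
    finally have "m * m * Z * (B * cstar B) = 0"
      by (intro sylvester_eq_0 cpositive_cstar m(1)) (simp only: m(2) P_def)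
    then show ?thesis by (simp add: m(2) Z_def P_def mult.assoc)
  qed
  from primeD[OF this] consider "a * u = 0" | "v * P = 0" by blast
  then show ?thesis
  proof cases
    case 1
    then have "u * u = 0" using hu by (subst u_def) (simp add: algebra_simps)
    with sauv(1) have "u = 0" by (rule selfadjoint_square_eq_0)
    then have "- h = a" by (simp add: u_def eq_neg_iff_add_eq_0 neg_eq_iff_add_eq_0 add.commute)
    with a(1) show ?thesis by simp
  next
    case 2
    \<comment> \<open>\<open>hP\<close> moves \<open>P\<close> next to \<open>v\<close>, where it is
      annihilated.\<close>
    have "v * h * Y * P = 0" for Y
    proof -
      have "v * h * Y * P = v * (h * Y * P)" by (simp only: mult.assoc)
      also have "\<dots> = v * (P * Y * h)" by (simp only: hP)
      also have "\<dots> = v * P * Y * h" by (simp only: mult.assoc)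
      finally show ?thesis using 2 by simp
    qed
    from primeD[OF this] P0 have "v * h = 0" by blast
    moreover from this vh have "v * a = 0" by simp
    ultimately have "v * v = 0" by (subst (2) v_def) (simp add: algebra_simps)
    with sauv(2) have "v = 0" by (rule selfadjoint_square_eq_0)
    with a(1) show ?thesis by (simp add: v_def)
  qed
qed

text \<open>By the dichotomy the closed sets \<open>{t. h \<le> t B B\<^sup>*}\<close> and \<open>{t. h \<ge> t B B\<^sup>*}\<close> cover the
  line, so they meet.\<close>
lemma prime_selfadjoint_real_multiple:
  fixes h B :: "'a::cstar_algebra"
  assumes prime: "prime_ring TYPE('a)" and sa: "cstar h = h" and B: "B \<noteq> 0"
    and comm: "\<And>Y. h * Y * (B * cstar B) = B * cstar B * Y * h"
  shows "\<exists>t. h = t *\<^sub>R (B * cstar B)"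
proof -
  define P where "P = B * cstar B"
  have hP: "h * Y * P = P * Y * h" for Y using comm by (simp only: P_def)
  have posP: "cpositive P" using cpositive_cstar_mult[of "cstar B"] by (simp add: P_def cstar_cstar)
  have P0: "P \<noteq> 0" using B mult_cstar_self_eq_0 by (auto simp: P_def)
  then have negP: "\<not> cpositive (- P)" using cpositive_antisym posP by blast
  have sat: "cstar (h - t *\<^sub>R P) = h - t *\<^sub>R P" for t
    by (simp add: cstar_diff sa cstar_scaleR cpositive_cstar[OF posP])
  define S1 where "S1 = {t. cpositive (h - t *\<^sub>R P)}"
  define S2 where "S2 = {t. cpositive (t *\<^sub>R P - h)}"
  have closed_cpositive: "closed {t. cpositive (f t)}"
    if f: "\<And>X l. X \<longlonglongrightarrow> l \<Longrightarrow> (\<lambda>n. f (X n)) \<longlonglongrightarrow> f l" for f :: "real \<Rightarrow> 'a"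
    unfolding closed_sequential_limits
  proof (intro allI impI)
    fix X :: "nat \<Rightarrow> real" and l
    assume X: "(\<forall>n. X n \<in> {t. cpositive (f t)}) \<and> X \<longlonglongrightarrow> l"
    have "cpositive (f l)" by (rule cpositive_limit[OF _ f[of X]]) (use X in auto)
    then show "l \<in> {t. cpositive (f t)}" by simp
  qed
  have closed: "closed S1" "closed S2"
    unfolding S1_def S2_def by (rule closed_cpositive, intro tendsto_intros, assumption)+
  have cover: "S1 \<union> S2 = UNIV"
  proof -
    have "cpositive (h - t *\<^sub>R P) \<or> cpositive (- (h - t *\<^sub>R P))" for t
    proof (rule prime_sign_dichotomy[OF prime sat B])
      fix Y
      show "(h - t *\<^sub>R P) * Y * (B * cstar B) = B * cstar B * Y * (h - t *\<^sub>R P)"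
        unfolding P_def[symmetric] by (simp add: left_diff_distrib right_diff_distrib hP)
    qed
    then show ?thesis by (auto simp: S1_def S2_def)
  qed
  \<comment> \<open>If \<open>x - n P\<close> were positive for all \<open>n \<ge> 1\<close>,
    dividing by \<open>n\<close> would make \<open>- P\<close> positive in the limit.\<close>
  have lim: "(\<lambda>n. (1 / real (Suc n)) *\<^sub>R x - P) \<longlonglongrightarrow> 0 *\<^sub>R x - P" for x
    by (intro tendsto_intros) (rule LIMSEQ_Suc[OF lim_1_over_n])
  have unbounded: "\<exists>n. \<not> cpositive (x - real (Suc n) *\<^sub>R P)" for x
  proof (rule ccontr)
    assume "\<nexists>n. \<not> cpositive (x - real (Suc n) *\<^sub>R P)"
    then have "cpositive ((1 / real (Suc n)) *\<^sub>R (x - real (Suc n) *\<^sub>R P))" for n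
      by (intro cpositive_scaleR) auto
    then have "cpositive ((1 / real (Suc n)) *\<^sub>R x - P)" for n
      by (simp add: scaleR_diff_right)
    with lim[of x] negP show False using cpositive_limit by force
  qed
  obtain n where "\<not> cpositive (h - real (Suc n) *\<^sub>R P)" using unbounded by blast
  then have "real (Suc n) \<notin> S1" by (simp add: S1_def)
  then have ne2: "S2 \<noteq> {}" using cover by blast
  obtain n where "\<not> cpositive (- h - real (Suc n) *\<^sub>R P)" using unbounded by blast
  moreover have "- h - c *\<^sub>R P = (- c) *\<^sub>R P - h" for c by (simp add: algebra_simps)
  ultimately have "- real (Suc n) \<notin> S2" by (simp only: S2_def mem_Collect_eq) simp
  then have ne1: "S1 \<noteq> {}" using cover by blast
  have "S1 \<inter> S2 \<noteq> {}"
    using connected_UNIV[where 'a = real] closed cover ne1 ne2 unfolding connected_closed by auto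
  then obtain t where "cpositive (h - t *\<^sub>R P)" "cpositive (- (h - t *\<^sub>R P))"
    by (auto simp: S1_def S2_def)
  then have "h - t *\<^sub>R P = 0" by (rule cpositive_antisym)
  then show ?thesis by (auto simp: P_def)
qed

lemma prime_conjugation_eq:
  fixes B C :: "'a::cstar_algebra"
  assumes prime: "prime_ring TYPE('a)" and eq: "\<And>X. C * X * cstar C = B * X * cstar B"
  shows "\<exists>l. cmod l = 1 \<and> B = cscale l C"
proof (cases "B = 0")
  case True
  then have "C * cstar C = 0" using eq[of 1] by simp
  then have "C = 0" by (rule mult_cstar_self_eq_0)
  with True show ?thesis by (intro exI[of _ 1]) simp
next
  case False
  define P where "P = B * cstar B"
  define Q where "Q = B * cstar C"
  define Q' where "Q' = C * cstar B"
  have CC: "C * cstar C = P" using eq[of 1] by (simp add: P_def)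
  have star: "cstar Q = Q'" "cstar Q' = Q" "cstar P = P"
    by (simp_all add: P_def Q_def Q'_def cstar_mult cstar_cstar)
  have P0: "P \<noteq> 0" using False mult_cstar_self_eq_0 by (auto simp: P_def)
  have QP: "Q * Y * P = P * Y * Q" for Y
  proof -
    \<comment> \<open>\<open>eq\<close> is used at \<open>X = cstar C * Y * B\<close>.\<close>
    have "Q * Y * P = B * (cstar C * Y * B) * cstar B" by (simp only: Q_def P_def mult.assoc)
    also have "\<dots> = C * (cstar C * Y * B) * cstar C" by (rule eq[symmetric])
    finally show ?thesis by (simp only: Q_def CC[symmetric] mult.assoc)
  qed
  have QP': "Q' * Y * P = P * Y * Q'" for Y
  proof -
    have "Q' * Y * P = C * (cstar B * Y * C) * cstar C"
      by (simp only: Q'_def CC[symmetric] mult.assoc)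
    also have "\<dots> = B * (cstar B * Y * C) * cstar B" by (rule eq)
    finally show ?thesis by (simp only: P_def Q'_def mult.assoc)
  qed
  have Q'Q: "Q' * Q = P * P"
    using eq[of "cstar B * B"] by (simp only: P_def Q_def Q'_def mult.assoc)
  define R where "R = Q + Q'"
  define S where "S = cscale \<i> (Q - Q')"
  have "\<exists>r. R = r *\<^sub>R (B * cstar B)"
  proof (rule prime_selfadjoint_real_multiple[OF prime _ False])
    show "cstar R = R" by (simp add: R_def cstar_add star add.commute)
    show "R * Y * (B * cstar B) = B * cstar B * Y * R" for Y
      unfolding P_def[symmetric] by (simp add: R_def distrib_left distrib_right QP QP')
  qed
  then obtain r where r: "R = r *\<^sub>R P" by (auto simp: P_def)
  have "\<exists>s. S = s *\<^sub>R (B * cstar B)"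
  proof (rule prime_selfadjoint_real_multiple[OF prime _ False])
    show "cstar S = S"
      by (simp add: S_def cstar_cscale cstar_diff star cscale_minus_left cscale_diff_right)
    show "S * Y * (B * cstar B) = B * cstar B * Y * S" for Y
      unfolding P_def[symmetric]
      by (simp add: S_def left_diff_distrib right_diff_distrib QP QP')
  qed
  then obtain s where s: "S = s *\<^sub>R P" by (auto simp: P_def)
  \<comment> \<open>Read off from \<open>2 Q = R - i S\<close>.\<close>
  define l where "l = (r - \<i> * s) / 2"
  have "Q = cscale (1/2) (R - cscale \<i> S)"
  proof -
    have "R - cscale \<i> S = cscale 2 Q"
      using cscale_add_left[of 1 1 Q] by (simp add: R_def S_def cscale_minus_left)
    then show ?thesis by simp
  qed
  then have Q: "Q = cscale l P"
    unfolding r s by (simp add: l_def cscale_diff_left[symmetric] diff_divide_distrib mult_ac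
        flip: cscale_of_real cscale_diff_right)
  then have Q': "Q' = cscale (cnj l) P" by (simp add: star cstar_cscale flip: star(1))
  have "cscale (l * cnj l - 1) (P * P) = 0"
    using Q'Q by (simp add: Q Q' cscale_diff_left)
  then have "cmod (l * cnj l - 1) * norm (P * P) = 0" by (simp only: norm_cscale[symmetric] norm_zero)
  moreover have "P * P \<noteq> 0" using P0 star(3) selfadjoint_square_eq_0 by blast
  ultimately have ll: "l * cnj l = 1" by simp
  have "(B - cscale l C) * cstar (B - cscale l C)
      = P - cscale (cnj l) Q - cscale l Q' + cscale (l * cnj l) P"
    by (simp add: cstar_diff cstar_cscale left_diff_distrib right_diff_distrib cscale_diff_right
        mult.commute[of "cnj l"] CC Q_def[symmetric] Q'_def[symmetric] P_def[symmetric])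
  also have "\<dots> = 0" by (simp add: Q Q' ll mult.commute[of "cnj l"])
  finally have "B - cscale l C = 0" by (rule mult_cstar_self_eq_0)
  moreover have "cmod l = 1"
    using ll by (metis complex_mod_sqrt_Re_mult_cnj norm_one one_complex.sel(1) real_sqrt_one)
  ultimately show ?thesis by auto
qed

section \<open>Linear extension from squares, and the theorem\<close>

text \<open>The difference of both sides is linear in \<open>X\<close>. Expanding the square of
  \<open>Y + 1\<close> shows that it kills every \<open>cstar Y + Y\<close>, and these elements span
  the algebra over the complex numbers.\<close>

lemma conjugation_eq_if_on_squares:
  fixes B C :: "'a::cstar_algebra"
  assumes sq: "\<And>A. C * (cstar A * A) * cstar C = B * (cstar A * A) * cstar B"
  shows "C * X * cstar C = B * X * cstar B"
proof -
  define D where "D Y = C * Y * cstar C - B * Y * cstar B" for Y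
  have add: "D (Y + Z) = D Y + D Z" for Y Z by (simp add: D_def algebra_simps)
  have scale: "D (cscale c Y) = cscale c (D Y)" for c Y by (simp add: D_def cscale_diff_right)
  have D0: "D (cstar A * A) = 0" for A by (simp add: D_def sq)
  have 1: "D (cstar Y + Y) = 0" for Y
  proof -
    have "cstar (Y + 1) * (Y + 1) = cstar Y * Y + (cstar 1 * 1 + (cstar Y + Y))"
      by (simp add: cstar_add algebra_simps)
    with D0[of "Y + 1"] show ?thesis by (simp only: add D0) simp
  qed
  have "cscale 2 X = (cstar X + X) + cscale (- \<i>) (cstar (cscale \<i> X) + cscale \<i> X)"
    using cscale_add_left[of 1 1 X]
    by (simp add: cstar_cscale cscale_minus_left cscale_diff_right cscale_add_right)
  then have "D (cscale 2 X) = 0" by (simp only: add[of "cstar X + X"] scale 1) simp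
  then have "D X = 0" using norm_cscale[of 2 "D X"] by (simp add: scale)
  then show ?thesis by (simp add: D_def)
qed

theorem theorem2:
  fixes \<phi> :: "'a::cstar_algebra \<Rightarrow> 'a"
  assumes "prime_ring TYPE('a)"
    and "surj \<phi>"
    and "\<forall>A B. cabs (\<phi> A * cstar (\<phi> B)) = cabs (A * cstar B)"
  shows "\<exists>U \<psi>. unitary U \<and> (\<forall>A. cmod (\<psi> A) = 1) \<and>
           (\<forall>A. \<phi> A = cscale (\<psi> A) (A * U))"
proof -
  define W where "W = \<phi> 1"
  have conj: "\<phi> B * (cstar (\<phi> A) * \<phi> A) * cstar (\<phi> B) = B * (cstar A * A) * cstar B" for A B
    using cabs_eqD[OF assms(3)[rule_format, of A B]] by (simp add: cstar_mult cstar_cstar mult.assoc)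
  \<comment> \<open>For \<open>B = A\<close> both arguments of \<open>cabs\<close> are positive, so
    \<open>cabs\<close> leaves them unchanged.\<close>
  have diag: "\<phi> A * cstar (\<phi> A) = A * cstar A" for A
  proof -
    have "cabs (X * cstar X) = X * cstar X" for X :: 'a
      using cabs_cpositive[OF cpositive_cstar_mult[of "cstar X"]] by (simp add: cstar_cstar)
    then show ?thesis using assms(3) by metis
  qed
  have WW: "W * cstar W = 1" using diag[of 1] by (simp add: W_def)
  have WW': "cstar W * W = 1"
  proof -
    \<comment> \<open>Surjectivity enters here: for a preimage \<open>A\<close> of 1,
      \<open>conj\<close> gives \<open>cstar W * W = A * cstar A\<close>, which \<open>diag\<close>
      evaluates to 1.\<close>
    obtain A where A: "\<phi> A = 1" using assms(2) by (metis surjD)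
    show ?thesis using conj[of A 1] diag[of A] by (simp add: A W_def)
  qed
  have sq: "cstar (\<phi> A) * \<phi> A = cstar W * (cstar A * A) * W" for A
  proof -
    have "W * (cstar (\<phi> A) * \<phi> A) * cstar W = cstar A * A" using conj[of 1 A] by (simp add: W_def)
    then have "cstar W * (cstar A * A) * W
        = cstar W * (W * (cstar (\<phi> A) * \<phi> A) * cstar W) * W" by simp
    also have "\<dots> = (cstar W * W) * (cstar (\<phi> A) * \<phi> A) * (cstar W * W)"
      by (simp only: mult.assoc)
    finally show ?thesis by (simp add: WW')
  qed
  have "\<exists>l. cmod l = 1 \<and> \<phi> B = cscale l (B * W)" for B
  proof -
    \<comment> \<open>Substituting \<open>sq\<close> into \<open>conj\<close> removes
      \<open>\<phi> A\<close>, leaving two conjugations that agree on squares.\<close>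
    have "B * (cstar A * A) * cstar B
        = \<phi> B * cstar W * (cstar A * A) * cstar (\<phi> B * cstar W)" for A
      using conj[of B A] by (simp add: sq cstar_mult cstar_cstar mult.assoc)
    then have "B * X * cstar B = \<phi> B * cstar W * X * cstar (\<phi> B * cstar W)" for X
      by (rule conjugation_eq_if_on_squares)
    from prime_conjugation_eq[OF assms(1) this] obtain l where
      l: "cmod l = 1" "\<phi> B * cstar W = cscale l B" by blast
    have "\<phi> B = \<phi> B * cstar W * W" by (simp add: mult.assoc WW')
    with l show ?thesis by auto
  qed
  then obtain \<psi> where "\<And>B. cmod (\<psi> B) = 1 \<and> \<phi> B = cscale (\<psi> B) (B * W)" by metis
  moreover have "unitary W" by (simp add: unitary_def WW WW')
  ultimately show ?thesis by blast
qed

end
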